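(* Let a power grid containing a busbar coupler $s$ (joining two distinct buses) be given, and assume that the grid with open coupler is connected. Let $\boldsymbol B_o$ be the grounded Laplacian of the grid with open coupler, and let $\boldsymbol B_c^{-1}=\lim_{b_s\to\infty}(\boldsymbol B_o+b_s\boldsymbol\nu_s\boldsymbol\nu_s^\top)^{-1}$ be the inverse grounded Laplacian of the grid with closed (but not merged) coupler. Let $\mathbf{PTDF}_o$ and $\mathbf{PTDF}_c$ be the PTDF matrices of the grid with open coupler and of the grid with closed coupler, respectively. Then the PTDF matrix of the grid with the open busbar coupler is given by $$\mathbf{PTDF}_o=\mathbf{PTDF}_c+\mathbf{bsdf}\;\boldsymbol\nu_s^\top\big(\mathbb 1-\boldsymbol B_o\boldsymbol B_c^{-1}\big)$$ with the bus split distribution factor vector $$\mathbf{bsdf}=\Big[\boldsymbol\nu_s^\top\big(\boldsymbol B_o-\boldsymbol B_o\boldsymbol B_c^{-1}\boldsymbol B_o\big)\boldsymbol\nu_s\Big]^{-1}\mathfrak B_o\boldsymbol E^\top\big(\mathbb 1-\boldsymbol B_c^{-1}\boldsymbol B_o\big)\boldsymbol\nu_s .$$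
   Context: A grid is a finite graph with buses (nodes) $1,\dots,N_n$ and branches (edges) $1,\dots,N_e$, each branch joining two distinct buses (parallel branches allowed) and carrying a fixed orientation. One bus is chosen as slack bus. The grounded node-edge incidence matrix $\boldsymbol E$ has size $(N_n-1)\times N_e$: $E_{n,e}=+1$ if branch $e$ starts at bus $n$, $-1$ if it ends at $n$, $0$ otherwise, with the row of the slack bus removed. $\boldsymbol u_e$ is the $e$-th standard basis vector of $\mathbb R^{N_e}$ and $\boldsymbol\nu_e=\boldsymbol E\boldsymbol u_e$. $\mathbb 1$ is the identity matrix. One of the branches is the busbar coupler $s$, also included as a column of $\boldsymbol E$. All branches $e\neq s$ have susceptance $b_e>0$. The coupler has susceptance $b_s=0$ when open and $b_s\to\infty$ when closed. Let $\mathfrak B_o$ be the diagonal matrix of branch susceptances of the open grid, with entries $b_e$ for $e\ne s$ and $0$ for $e=s$, and let $\mathfrak B_c=\mathfrak B_o+b_s\boldsymbol u_s\boldsymbol u_s^\top$ be that of the closed grid. The grounded Laplacian of the open grid is $\boldsymbol B_o=\boldsymbol E\,\mathfrak B_o\boldsymbol E^\top$; "connected with open coupler" means that the graph with all branches $e\neq s$ is connected, so that $\boldsymbol B_o$ is invertible. For finite $b_s>0$ the grounded Laplacian of the closed (not merged) grid is $\boldsymbol E\,\mathfrak B_c\boldsymbol E^\top=\boldsymbol B_o+b_s\boldsymbol\nu_s\boldsymbol\nu_s^\top$. The symbol $\boldsymbol B_c^{-1}$ denotes the entrywise limit of its inverse as $b_s\to\infty$ (this limit is a singular matrix, so the symbol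 is notation and not the inverse of a matrix). The PTDF (power transfer distribution factor) matrix of a grid configuration maps the vector of power injections $\boldsymbol p$ to the vector of branch flows. For the open grid it is $\mathbf{PTDF}_o=\mathfrak B_o\boldsymbol E^\top\boldsymbol B_o^{-1}$. For the closed grid it is $\mathbf{PTDF}_c=\mathfrak B_c\boldsymbol E^\top(\boldsymbol E\,\mathfrak B_c\boldsymbol E^\top)^{-1}$, taken in the limit $b_s\to\infty$.
   Formalization: The PTDF identity is stated only for the rows of branches other than the coupler s; in the coupler's own row it fails for every such grid, since that row is zero in PTDF_o and bsdf but nonzero in the limit PTDF_c. *)

theory Defs
  imports "HOL-Analysis.Analysis"
begin

text \<open>
  Buses are the elements of a finite type \<open>'v\<close>, branches those of a finite type \<open>'e\<close>;
  branch \<open>e\<close> is oriented from \<open>src e\<close> to \<open>dst e\<close>. The rows of grounded matrices are indexed by a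
  type \<open>'n\<close> that is identified with the non-slack buses by an enumeration \<open>bus\<close>. This
  makes the number of rows one less than the number of buses.
\<close>

definition power_grid :: "('e::finite \<Rightarrow> 'v::finite) \<Rightarrow> ('e \<Rightarrow> 'v) \<Rightarrow> 'v \<Rightarrow> ('n::finite \<Rightarrow> 'v) \<Rightarrow> bool"
  where "power_grid src dst slack bus \<longleftrightarrow>
    (\<forall>e. src e \<noteq> dst e) \<and> bij_betw bus UNIV (UNIV - {slack})"

definition connected_by :: "('e \<Rightarrow> 'v) \<Rightarrow> ('e \<Rightarrow> 'v) \<Rightarrow> 'e set \<Rightarrow> bool"
  where "connected_by src dst A \<longleftrightarrow>
    (\<forall>u v. (u, v) \<in> (\<Union>e\<in>A. {(src e, dst e), (dst e, src e)})\<^sup>*)"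

definition incidence :: "('e::finite \<Rightarrow> 'v) \<Rightarrow> ('e \<Rightarrow> 'v) \<Rightarrow> ('n::finite \<Rightarrow> 'v) \<Rightarrow> real^'e^'n"
  where "incidence src dst bus =
    (\<chi> n e. if src e = bus n then 1 else if dst e = bus n then - 1 else 0)"

definition outer :: "real^'m \<Rightarrow> real^'n \<Rightarrow> real^'n^'m"
  where "outer u v = (\<chi> i j. u $ i * v $ j)"

text \<open>The value \<open>b s\<close> is ignored: the open coupler has susceptance zero.\<close>

definition susceptance_open :: "('e::finite \<Rightarrow> real) \<Rightarrow> 'e \<Rightarrow> real^'e^'e"
  where "susceptance_open b s = (\<chi> i j. if i = j \<and> i \<noteq> s then b i else 0)"

definition susceptance_closed :: "('e::finite \<Rightarrow> real) \<Rightarrow> 'e \<Rightarrow> real \<Rightarrow> real^'e^'e"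
  where "susceptance_closed b s t =
    susceptance_open b s + t *\<^sub>R outer (axis s 1) (axis s 1)"

definition laplacian :: "real^'e^'n \<Rightarrow> real^'e^'e \<Rightarrow> real^'n^'n"
  where "laplacian E D = E ** D ** transpose E"

definition ptdf :: "real^'e^'n \<Rightarrow> real^'e^'e \<Rightarrow> real^'n^'e"
  where "ptdf E D = D ** transpose E ** matrix_inv (laplacian E D)"

definition ptdf_open :: "real^'e^'n \<Rightarrow> ('e \<Rightarrow> real) \<Rightarrow> 'e \<Rightarrow> real^'n^'e"
  where "ptdf_open E b s = ptdf E (susceptance_open b s)"

text \<open>
  Row \<open>s\<close> of this limit is the flow through the ideally closed coupler: an unbounded
  susceptance times a vanishing angle difference. If the open grid is connected, that row is not
  zero, whereas row \<open>s\<close> of \<open>ptdf_open E b s\<close> and of anything of the form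
  \<open>susceptance_open b s ** M\<close> is. A relation between the open and the closed PTDF whose
  correction term has the latter form can therefore hold only on the rows \<open>e \<noteq> s\<close>.
\<close>

definition ptdf_closed :: "real^'e^'n \<Rightarrow> ('e \<Rightarrow> real) \<Rightarrow> 'e \<Rightarrow> real^'n^'e"
  where "ptdf_closed E b s = Lim at_top (\<lambda>t. ptdf E (susceptance_closed b s t))"

text \<open>A limit of inverses; it is singular and not itself the inverse of a matrix.\<close>

definition closed_inv_laplacian :: "real^'n^'n \<Rightarrow> real^'n \<Rightarrow> real^'n^'n"
  where "closed_inv_laplacian B_o \<nu> = Lim at_top (\<lambda>t. matrix_inv (B_o + t *\<^sub>R outer \<nu> \<nu>))"

end

theory Submission
  imports Defs
begin

text \<open>
  With \<open>X\<close> the inverse of \<open>B_o\<close>, \<open>w = X *v \<nu>\<close> and \<open>q = \<nu> \<bullet> w\<close>, the Sherman--Morrison formula gives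
  \<open>X - t / (1 + t * q) *\<^sub>R outer w w\<close> as the inverse of the closed Laplacian, whose limit is
  \<open>X - (1 / q) *\<^sub>R outer w w\<close>. The open Laplacian is positive definite because a potential that
  vanishes at the slack bus and is constant along every branch of a connected grid is zero; this
  yields \<open>q > 0\<close>. As \<open>B_o *v w = \<nu>\<close>, the factors \<open>mat 1 - B_o ** Bc_inv\<close> and
  \<open>mat 1 - Bc_inv ** B_o\<close> are \<open>(1 / q) *\<^sub>R outer \<nu> w\<close> and \<open>(1 / q) *\<^sub>R outer w \<nu>\<close>, so the
  correction term restores exactly the rank-one part lost in the limit.
\<close>

section \<open>Algebra of rank-one matrices\<close>

lemma matrix_add_rdistrib: "(A + B) ** C = A ** C + B ** C" for C :: "real^'m^'n"
  by (simp add: matrix_matrix_mult_def vec_eq_iff sum.distrib algebra_simps)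

lemma matrix_diff_ldistrib: "A ** (B - C) = A ** B - A ** C" for A :: "real^'m^'n"
  by (simp add: matrix_matrix_mult_def vec_eq_iff sum_subtractf algebra_simps)

lemma matrix_diff_rdistrib: "(A - B) ** C = A ** C - B ** C" for C :: "real^'m^'n"
  by (simp add: matrix_matrix_mult_def vec_eq_iff sum_subtractf algebra_simps)

lemma outer_scaleR_left: "outer (c *\<^sub>R u) v = c *\<^sub>R outer u v"
  by (simp add: outer_def vec_eq_iff)

lemma outer_scaleR_right: "outer u (c *\<^sub>R v) = c *\<^sub>R outer u v"
  by (simp add: outer_def vec_eq_iff)

lemma outer_add_left: "outer (u + u') v = outer u v + outer u' v"
  by (simp add: outer_def vec_eq_iff distrib_right)

lemma outer_mult_vec: "outer u v *v x = (v \<bullet> x) *\<^sub>R u"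
  by (simp add: outer_def vec_eq_iff matrix_vector_mult_def inner_vec_def
      sum_distrib_right sum_distrib_left mult_ac)

lemma vec_mult_outer: "x v* outer u v = (x \<bullet> u) *\<^sub>R v"
  by (simp add: outer_def vec_eq_iff vector_matrix_mult_def inner_vec_def
      sum_distrib_right sum_distrib_left mult_ac)

lemma matrix_mult_outer: "A ** outer u v = outer (A *v u) v"
  by (simp add: outer_def vec_eq_iff matrix_matrix_mult_def matrix_vector_mult_def
      sum_distrib_right sum_distrib_left mult_ac)

lemma outer_mult_matrix: "outer u v ** A = outer u (v v* A)"
  by (simp add: outer_def vec_eq_iff matrix_matrix_mult_def vector_matrix_mult_def
      sum_distrib_right sum_distrib_left mult_ac)

text \<open>Expands products and absorbs every factor next to a rank-one matrix into one of its two
  vectors, so that matrix identities reduce to comparing scalar coefficients.\<close>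

lemmas outer_simps = matrix_add_ldistrib matrix_add_rdistrib matrix_diff_ldistrib
  matrix_diff_rdistrib scalar_matrix_assoc[symmetric] matrix_scalar_ac
  outer_scaleR_left outer_scaleR_right outer_add_left matrix_mult_outer outer_mult_matrix
  outer_mult_vec vec_mult_outer scaleR_matrix_vector_assoc[symmetric] matrix_vector_mult_scaleR

section \<open>Inverses and rank-one updates\<close>

lemma
  assumes "invertible A"
  shows matrix_inv_right: "A ** matrix_inv A = mat 1"
    and matrix_inv_left: "matrix_inv A ** A = mat 1"
  using assms someI_ex[of "\<lambda>A'. A ** A' = mat 1 \<and> A' ** A = mat 1"]
  unfolding invertible_def matrix_inv_def by blast+

text \<open>For square matrices a right inverse is also a left inverse, so one product suffices to
  identify \<open>matrix_inv A\<close>.\<close>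

lemma matrix_inv_unique_right:
  fixes A X :: "real^'n^'n"
  assumes "A ** X = mat 1"
  shows "invertible A" "matrix_inv A = X"
proof -
  have *: "X ** A = mat 1" using assms matrix_left_right_inverse by blast
  with assms show "invertible A" unfolding invertible_def by blast
  then have "matrix_inv A ** A = mat 1" by (rule matrix_inv_left)
  then have "matrix_inv A ** (A ** X) = X" by (simp add: matrix_mul_assoc)
  then show "matrix_inv A = X" by (simp add: assms)
qed

text \<open>Beyond \<open>mat 1\<close>, all terms of the product of the update with the claimed
  inverse are multiples of \<open>outer u (v v* X)\<close>; \<open>c\<close> is the scalar that
  makes their coefficients cancel.\<close>

lemma sherman_morrison:
  fixes A :: "real^'n^'n" and u v :: "real^'n" and t :: real
  defines "X \<equiv> matrix_inv A"
  assumes A: "invertible A" and nz: "1 + t * (v \<bullet> (X *v u)) \<noteq> 0"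
  defines "c \<equiv> t / (1 + t * (v \<bullet> (X *v u)))"
  shows "invertible (A + t *\<^sub>R outer u v)"
    "matrix_inv (A + t *\<^sub>R outer u v) = X - c *\<^sub>R outer (X *v u) (v v* X)"
proof -
  have AX: "A ** X = mat 1" unfolding X_def using A by (rule matrix_inv_right)
  then have Au: "A *v (X *v u) = u" by (simp add: matrix_vector_mul_assoc)
  have coeff: "t - c - t * c * (v \<bullet> (X *v u)) = 0"
    using nz by (simp add: c_def divide_simps algebra_simps)
  have "(A + t *\<^sub>R outer u v) ** (X - c *\<^sub>R outer (X *v u) (v v* X))
    = mat 1 + (t - c - t * c * (v \<bullet> (X *v u))) *\<^sub>R outer u (v v* X)"
    by (simp add: outer_simps AX Au dot_lmul_matrix algebra_simps)
  then have "(A + t *\<^sub>R outer u v) ** (X - c *\<^sub>R outer (X *v u) (v v* X)) = mat 1"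
    by (simp add: coeff)
  then show "invertible (A + t *\<^sub>R outer u v)"
    "matrix_inv (A + t *\<^sub>R outer u v) = X - c *\<^sub>R outer (X *v u) (v v* X)"
    by (rule matrix_inv_unique_right)+
qed

section \<open>Potentials and positive definiteness of the open Laplacian\<close>

text \<open>Undoes the grounding: extending \<open>x\<close> by 0 to the slack bus lets the slack
  bus be treated like any other in connectivity arguments.\<close>

lemma incidence_potential:
  fixes bus :: "'n::finite \<Rightarrow> 'v::finite" and x :: "real^'n"
  assumes grid: "power_grid src dst slack bus"
  obtains p where "p slack = 0" "\<And>n. p (bus n) = x $ n"
    "\<And>e. (transpose (incidence src dst bus) *v x) $ e = p (src e) - p (dst e)"
proof -
  \<comment> \<open>As \<open>bus\<close> is injective, at most one summand is present; at the slack
    bus there is none, which gives the value 0.\<close>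
  define p where "p v = (\<Sum>n\<in>UNIV. if v = bus n then x $ n else 0)" for v
  have bij: "bij_betw bus UNIV (UNIV - {slack})" and loop: "src e \<noteq> dst e" for e
    using grid by (auto simp: power_grid_def)
  have inj: "bus n = bus m \<longleftrightarrow> n = m" for n m
    using bij by (metis UNIV_I bij_betw_def inj_on_contraD)
  have "bus n \<noteq> slack" for n using bij by (auto simp: bij_betw_def)
  then have "p slack = 0" unfolding p_def by (simp add: eq_commute[of slack])
  moreover have "p (bus n) = x $ n" for n
    unfolding p_def by (simp add: inj)
  \<comment> \<open>The nested conditional in \<open>incidence\<close> matches the difference of the
    two indicators because the ends of \<open>e\<close> are distinct.\<close>
  moreover have "(transpose (incidence src dst bus) *v x) $ e = p (src e) - p (dst e)" for e
    unfolding p_def sum_subtractf[symmetric] matrix_vector_mult_def transpose_def incidence_def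
    using loop[of e] by (auto intro!: sum.cong)
  ultimately show thesis by (rule that)
qed

lemma connected_by_constant:
  assumes conn: "connected_by src dst A" and eq: "\<And>e. e \<in> A \<Longrightarrow> p (src e) = p (dst e)"
  shows "p u = p v"
proof -
  have "(u, v) \<in> (\<Union>e\<in>A. {(src e, dst e), (dst e, src e)})\<^sup>*"
    using conn by (simp add: connected_by_def)
  then show ?thesis
    by (induction rule: rtrancl_induct) (auto simp: eq)
qed

text \<open>The ends of \<open>s\<close> are distinct, so one of them is not the slack bus, and its
  row survives grounding with entry 1 or -1.\<close>

lemma incidence_column_nonzero:
  assumes grid: "power_grid src dst slack (bus :: 'n::finite \<Rightarrow> 'v::finite)"
  shows "incidence src dst bus *v axis s 1 \<noteq> 0"
proof -
  have bij: "bij_betw bus UNIV (UNIV - {slack})" and loop: "src s \<noteq> dst s"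
    using grid by (auto simp: power_grid_def)
  obtain v where v: "v = src s \<or> v = dst s" "v \<noteq> slack" using loop by metis
  then have "v \<in> range bus" using bij by (simp add: bij_betw_def)
  then obtain n where n: "bus n = v" by blast
  have "(incidence src dst bus *v axis s 1) $ n \<noteq> 0"
    using v n by (auto simp: matrix_vector_mul_component inner_axis incidence_def)
  then show ?thesis by (metis zero_index)
qed

lemma susceptance_open_mult_vec:
  "susceptance_open b s *v y = (\<chi> e. if e = s then 0 else b e * y $ e)"
proof -
  have "(susceptance_open b s *v y) $ e
      = (\<Sum>j\<in>UNIV. if j = e then (if e = s then 0 else b e * y $ e) else 0)" for e
    unfolding susceptance_open_def matrix_vector_mult_def vec_lambda_beta by (rule sum.cong) auto
  then show ?thesis by (simp add: vec_eq_iff)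
qed

lemma transpose_susceptance_open: "transpose (susceptance_open b s) = susceptance_open b s"
  by (auto simp: transpose_def susceptance_open_def vec_eq_iff)

text \<open>The quadratic form is the sum of \<open>b e\<close> times the squared potential
  difference over all branches except \<open>s\<close>. If it vanished, connectivity would make the
  potential constant, hence equal to its slack value 0.\<close>

lemma laplacian_open_pos_def:
  fixes bus :: "'n::finite \<Rightarrow> 'v::finite" and x :: "real^'n"
  assumes grid: "power_grid src dst slack bus"
    and pos: "\<And>e. e \<noteq> s \<Longrightarrow> b e > 0"
    and conn: "connected_by src dst (UNIV - {s})"
    and x: "x \<noteq> 0"
  shows "x \<bullet> (laplacian (incidence src dst bus) (susceptance_open b s) *v x) > 0"
proof -
  obtain p where p: "p slack = 0" "\<And>n. p (bus n) = x $ n"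
    "\<And>e. (transpose (incidence src dst bus) *v x) $ e = p (src e) - p (dst e)"
    using incidence_potential[OF grid] by blast
  let ?f = "\<lambda>e. if e = s then 0 else b e * (p (src e) - p (dst e))\<^sup>2"
  have eq: "x \<bullet> (laplacian (incidence src dst bus) (susceptance_open b s) *v x) = sum ?f UNIV"
  proof -
    let ?y = "transpose (incidence src dst bus) *v x"
    have "x \<bullet> (laplacian (incidence src dst bus) (susceptance_open b s) *v x)
        = ?y \<bullet> (susceptance_open b s *v ?y)"
      by (simp add: laplacian_def matrix_vector_mul_assoc[symmetric] dot_lmul_matrix)
    then show ?thesis
      by (auto simp: susceptance_open_mult_vec inner_vec_def p power2_eq_square
          simp del: transpose_matrix_vector intro!: sum.cong)
  qed
  have nonneg: "?f e \<ge> 0" for e using pos[of e] by (auto intro: less_imp_le)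
  have "sum ?f UNIV \<noteq> 0"
  proof
    assume "sum ?f UNIV = 0"
    then have "?f e = 0" for e
      using nonneg sum_nonneg_eq_0_iff[of UNIV ?f] by simp
    then have "p (src e) = p (dst e)" if "e \<in> UNIV - {s}" for e
      using that pos[of e] by (metis (no_types, lifting) Diff_iff eq_iff_diff_eq_0 insertI1
          less_irrefl mult_eq_0_iff power_eq_0_iff)
    then have "p u = p slack" for u by (rule connected_by_constant[OF conn])
    then have "x = 0" using p by (metis vec_eq_iff zero_index)
    with x show False ..
  qed
  moreover have "sum ?f UNIV \<ge> 0" by (intro sum_nonneg nonneg)
  ultimately show ?thesis unfolding eq by simp
qed

section \<open>Invertibility, symmetry and the closed Laplacian\<close>

lemma invertible_if_pos_def:
  fixes A :: "real^'n^'n"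
  assumes "\<And>x. x \<noteq> 0 \<Longrightarrow> x \<bullet> (A *v x) > 0"
  shows "invertible A"
proof -
  have "\<forall>x. A *v x = 0 \<longrightarrow> x = 0" using assms by (metis inner_zero_right less_irrefl)
  then show ?thesis
    by (simp add: invertible_left_inverse matrix_left_invertible_ker)
qed

lemma transpose_laplacian:
  "transpose D = D \<Longrightarrow> transpose (laplacian E D) = laplacian E D" for E :: "real^'e^'n"
  by (simp add: laplacian_def matrix_transpose_mul matrix_mul_assoc)

lemma transpose_matrix_inv:
  fixes A :: "real^'n^'n"
  assumes "invertible A" "transpose A = A"
  shows "transpose (matrix_inv A) = matrix_inv A"
proof -
  have "A ** transpose (matrix_inv A) = transpose (matrix_inv A ** A)"
    by (simp add: matrix_transpose_mul assms(2))
  also have "\<dots> = mat 1" by (simp add: matrix_inv_left assms(1) transpose_mat)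
  finally show ?thesis using matrix_inv_unique_right(2) by metis
qed

text \<open>Closing the coupler is a rank-one update, so \<open>sherman_morrison\<close>
  applies.\<close>

lemma laplacian_closed:
  "laplacian E (susceptance_closed b s t)
    = laplacian E (susceptance_open b s) + t *\<^sub>R outer (E *v axis s 1) (E *v axis s 1)"
  by (simp add: laplacian_def susceptance_closed_def outer_simps)

section \<open>Limits for the closing coupler and comparison of the PTDF matrices\<close>

theorem corollary1:
  fixes src dst :: "'e::finite \<Rightarrow> 'v::finite" and slack :: 'v
    and bus :: "'n::finite \<Rightarrow> 'v"
    and b :: "'e \<Rightarrow> real" and s :: 'e
    and E :: "real^'e^'n" and B_o Bc_inv :: "real^'n^'n"
    and \<nu> :: "real^'n" and \<kappa> :: real and bsdf :: "real^'e"
  assumes grid: "power_grid src dst slack bus"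
    and pos: "\<And>e. e \<noteq> s \<Longrightarrow> b e > 0"
    and conn: "connected_by src dst (UNIV - {s})"
    and E: "E = incidence src dst bus"
    and nu: "\<nu> = E *v axis s 1"
    and Bo: "B_o = laplacian E (susceptance_open b s)"
    and Bc: "Bc_inv = closed_inv_laplacian B_o \<nu>"
    and kappa: "\<kappa> = \<nu> \<bullet> ((B_o - B_o ** Bc_inv ** B_o) *v \<nu>)"
    and bsdf: "bsdf = inverse \<kappa> *\<^sub>R
      ((susceptance_open b s ** transpose E ** (mat 1 - Bc_inv ** B_o)) *v \<nu>)"
  shows "invertible B_o \<and>
    (\<forall>t>0. invertible (B_o + t *\<^sub>R outer \<nu> \<nu>)) \<and>
    ((\<lambda>t. matrix_inv (B_o + t *\<^sub>R outer \<nu> \<nu>)) \<longlongrightarrow> Bc_inv) at_top \<and>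
    ((\<lambda>t. ptdf E (susceptance_closed b s t)) \<longlongrightarrow> ptdf_closed E b s) at_top \<and>
    \<kappa> \<noteq> 0 \<and>
    (\<forall>e. e \<noteq> s \<longrightarrow> ptdf_open E b s $ e =
      (ptdf_closed E b s + outer bsdf (\<nu> v* (mat 1 - B_o ** Bc_inv))) $ e)"
proof -
  define S where "S = susceptance_open b s"
  define X where "X = matrix_inv B_o"
  define w where "w = X *v \<nu>"
  define q where "q = \<nu> \<bullet> w"
  define c where "c t = t / (1 + t * q)" for t
  have pd: "x \<bullet> (B_o *v x) > 0" if "x \<noteq> 0" for x
    unfolding Bo E using laplacian_open_pos_def grid pos conn that by blast
  then have inv: "invertible B_o" by (rule invertible_if_pos_def)
  have BX: "B_o ** X = mat 1" and XB: "X ** B_o = mat 1"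
    unfolding X_def using inv by (auto intro: matrix_inv_right matrix_inv_left)
  have tB: "transpose B_o = B_o"
    unfolding Bo by (intro transpose_laplacian transpose_susceptance_open)
  have vX: "\<nu> v* X = w"
    unfolding w_def by (metis X_def inv tB transpose_matrix_inv transpose_matrix_vector)
  have Bw: "B_o *v w = \<nu>" by (simp add: w_def matrix_vector_mul_assoc BX)
  have wB: "w v* B_o = \<nu>" by (metis Bw tB transpose_matrix_vector)
  have \<nu>0: "\<nu> \<noteq> 0" unfolding nu E by (rule incidence_column_nonzero[OF grid])
  then have "w \<noteq> 0" using Bw by auto
  \<comment> \<open>Since \<open>B_o *v w\<close> is \<nu>, \<open>q\<close> is the quadratic form
    of \<open>B_o\<close> at \<open>w\<close>.\<close>
  then have q: "q > 0" using pd[of w] by (simp add: q_def Bw inner_commute)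
  have \<nu>\<nu>: "\<nu> \<bullet> \<nu> \<noteq> 0" using \<nu>0 by simp
  have nz: "1 + t * (\<nu> \<bullet> (matrix_inv B_o *v \<nu>)) \<noteq> 0" if "t > 0" for t
    using that q by (simp add: X_def[symmetric] w_def[symmetric] q_def[symmetric] add_pos_pos
        less_imp_neq[symmetric])
  then have nz': "1 + t * q \<noteq> 0" if "t > 0" for t
    using that by (simp add: X_def[symmetric] w_def[symmetric] q_def[symmetric])
  have inv_t: "invertible (B_o + t *\<^sub>R outer \<nu> \<nu>)" if "t > 0" for t
    by (rule sherman_morrison[OF inv nz[OF that]])
  have minv_t: "matrix_inv (B_o + t *\<^sub>R outer \<nu> \<nu>) = X - c t *\<^sub>R outer w w" if "t > 0" for t
    using sherman_morrison(2)[OF inv nz[OF that]]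
    by (simp add: X_def[symmetric] w_def[symmetric] q_def[symmetric] c_def vX)
  have c_lim: "(c \<longlongrightarrow> 1 / q) at_top"
  proof -
    \<comment> \<open>Dividing numerator and denominator of \<open>c t\<close> by \<open>t\<close>
      leaves only \<open>inverse t\<close>, which tends to 0.\<close>
    have "((\<lambda>t. 1 / (inverse t + q)) \<longlongrightarrow> 1 / (0 + q)) at_top"
      using q by (intro tendsto_intros tendsto_inverse_0_at_top filterlim_ident) auto
    moreover have "\<forall>\<^sub>F t in at_top. 1 / (inverse t + q) = c t"
      using eventually_gt_at_top[of 0]
    proof eventually_elim
      case (elim t)
      then have "1 + t * q > 0" "inverse t + q > 0" using q by (simp_all add: add_pos_pos)
      with elim show ?case by (simp add: c_def field_simps)
    qed
    ultimately show ?thesis by (simp add: tendsto_cong)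
  qed
  define L where "L = X - (1 / q) *\<^sub>R outer w w"
  have lim: "((\<lambda>t. matrix_inv (B_o + t *\<^sub>R outer \<nu> \<nu>)) \<longlongrightarrow> L) at_top"
  proof (rule Lim_transform_eventually)
    show "((\<lambda>t. X - c t *\<^sub>R outer w w) \<longlongrightarrow> L) at_top"
      unfolding L_def by (intro tendsto_intros c_lim)
    show "\<forall>\<^sub>F t in at_top. X - c t *\<^sub>R outer w w = matrix_inv (B_o + t *\<^sub>R outer \<nu> \<nu>)"
      using eventually_gt_at_top[of 0] by eventually_elim (simp add: minv_t)
  qed
  \<comment> \<open>\<open>Lim\<close> is a choice operator; the convergence just shown and
    uniqueness of limits fix its value.\<close>
  have Bc_L: "Bc_inv = L"
    unfolding Bc closed_inv_laplacian_def using lim by (simp add: tendsto_Lim)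
  \<comment> \<open>The last summand lives in row \<open>s\<close> alone: it is the limiting flow
    through the coupler.\<close>
  define P where "P = S ** transpose E ** L + (1 / q) *\<^sub>R outer (axis s 1) w"
  have ptdf_t: "ptdf E (susceptance_closed b s t)
      = S ** transpose E ** (X - c t *\<^sub>R outer w w) + c t *\<^sub>R outer (axis s 1) w"
    if "t > 0" for t
  proof -
    \<comment> \<open>The growing susceptance \<open>t\<close> meets the angle difference factor
      \<open>1 - c t * q\<close>, which is \<open>1 / (1 + t * q)\<close>; their product
      \<open>c t\<close> stays bounded.\<close>
    have "t - t * (c t * q) = c t"
      using nz'[OF that] by (simp add: c_def divide_simps) (simp add: algebra_simps)
    then have "t *\<^sub>R w - (t * (c t * q)) *\<^sub>R w = c t *\<^sub>R w"
      by (metis scaleR_diff_left)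
    then have "t *\<^sub>R outer (axis s 1) (\<nu> v* (X - c t *\<^sub>R outer w w)) = c t *\<^sub>R outer (axis s 1) w"
      unfolding outer_scaleR_right[symmetric]
      by (simp add: vX vector_matrix_mult_diff_rdistrib vec_mult_outer q_def[symmetric]
          vector_scaleR_matrix_ac scaleR_diff_right outer_scaleR_right)
    then show ?thesis
      unfolding ptdf_def laplacian_closed Bo[symmetric] nu[symmetric] minv_t[OF that]
      by (simp add: susceptance_closed_def S_def matrix_add_rdistrib scalar_matrix_assoc[symmetric]
          outer_mult_matrix nu[symmetric])

  qed
  have plim: "((\<lambda>t. ptdf E (susceptance_closed b s t)) \<longlongrightarrow> P) at_top"
  proof (rule Lim_transform_eventually)
    show "((\<lambda>t. S ** transpose E ** (X - c t *\<^sub>R outer w w) + c t *\<^sub>R outer (axis s 1) w) \<longlongrightarrow> P) at_top"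
      unfolding P_def L_def matrix_diff_ldistrib matrix_scalar_ac scalar_matrix_assoc[symmetric]
      by (intro tendsto_intros c_lim)
    show "\<forall>\<^sub>F t in at_top. S ** transpose E ** (X - c t *\<^sub>R outer w w) + c t *\<^sub>R outer (axis s 1) w
        = ptdf E (susceptance_closed b s t)"
      using eventually_gt_at_top[of 0] by eventually_elim (simp add: ptdf_t)
  qed
  have P: "ptdf_closed E b s = P"
    unfolding ptdf_closed_def using plim by (simp add: tendsto_Lim)
  have BL: "mat 1 - B_o ** L = (1 / q) *\<^sub>R outer \<nu> w"
    by (simp add: L_def outer_simps BX Bw)
  have LB: "mat 1 - L ** B_o = (1 / q) *\<^sub>R outer w \<nu>"
    by (simp add: L_def outer_simps XB wB)
  have "B_o - B_o ** L ** B_o = (mat 1 - B_o ** L) ** B_o"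
    by (simp add: matrix_diff_rdistrib)
  also have "\<dots> = (1 / q) *\<^sub>R outer \<nu> \<nu>" by (simp add: BL outer_simps wB)
  finally have \<kappa>: "\<kappa> = (\<nu> \<bullet> \<nu>)\<^sup>2 / q"
    by (simp add: kappa Bc_L scaleR_matrix_vector_assoc[symmetric] outer_mult_vec power2_eq_square)
  have "bsdf = (inverse \<kappa> * ((\<nu> \<bullet> \<nu>) / q)) *\<^sub>R ((S ** transpose E) *v w)"
    unfolding bsdf Bc_L LB S_def
    by (simp add: matrix_vector_mul_assoc[symmetric] scaleR_matrix_vector_assoc[symmetric]
        outer_simps matrix_vector_mult_scaleR)
  also have "inverse \<kappa> * ((\<nu> \<bullet> \<nu>) / q) = inverse (\<nu> \<bullet> \<nu>)"
    using \<nu>\<nu> q by (simp add: \<kappa> power2_eq_square field_simps)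
  \<comment> \<open>The row factor equals \<open>w\<close> scaled by the squared norm of \<nu> over
    \<open>q\<close>; this norm cancels against the one in \<open>bsdf\<close>.\<close>
  finally have "outer bsdf (\<nu> v* (mat 1 - B_o ** Bc_inv))
      = (1 / q) *\<^sub>R outer ((S ** transpose E) *v w) w"
    using \<nu>\<nu> by (simp add: Bc_L BL vector_scaleR_matrix_ac outer_simps)
  then have "ptdf_closed E b s + outer bsdf (\<nu> v* (mat 1 - B_o ** Bc_inv))
      = ptdf_open E b s + (1 / q) *\<^sub>R outer (axis s 1) w"
    by (simp add: P P_def L_def ptdf_open_def ptdf_def X_def Bo
        S_def[symmetric] outer_simps)
  \<comment> \<open>The surplus over the open PTDF is confined to row \<open>s\<close>, so the two
    sides agree in every other row.\<close>
  moreover have "outer (axis s 1) w $ e = 0" if "e \<noteq> s" for e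
    using that by (simp add: outer_def axis_def vec_eq_iff)
  moreover have "\<kappa> \<noteq> 0" using \<nu>\<nu> q by (simp add: \<kappa>)
  ultimately show ?thesis using inv inv_t lim plim by (simp add: Bc_L P)
qed

end
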